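(* Let $f(x)=\dfrac{1+x}{\cos(x)^{s+1}}$, regarded as a formal power series in $x$ whose coefficients are polynomials in the parameter $s$. Then for all $n\ge1$ and all $s$, $$\ddot H_n(f)=c_n\prod_{i=1}^{n-1}(s+1)_i=c_n\prod_{j=1}^{n-1}(s+j)^{\,n-j}, \qquad c_n=\frac{2^{\binom n2}\,\bigl((n-1)!!\bigr)^2\prod_{k=1}^{n-2}(k!!)^6}{\prod_{i=1}^{n-1}i!}.$$ The constant $c_n$ is exactly the value $\ddot H_n(f)\big|_{s=0}$ divided by $\prod_{i=1}^{n-1}i!$.
   Context: For a power series $f(x)=\sum_{k\ge0}a_kx^k/k!$, the dilated Hankel determinant is $\ddot H_n(f)=\det(a_{2i+j})_{0\le i,j\le n-1}$. $(s+1)_i=(s+1)(s+2)\cdots(s+i)$. Conventions: $m!!=m(m-2)(m-4)\cdots$ down to $1$ or $2$, with $0!!=(-1)!!=1$; empty products equal $1$. *)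

theory Defs
  imports
    "HOL-Computational_Algebra.Formal_Power_Series"
    "Jordan_Normal_Form.Determinant"
begin

definition egf_coeff :: "'a :: comm_semiring_1 fps \<Rightarrow> nat \<Rightarrow> 'a" where
  "egf_coeff f k = of_nat (fact k) * fps_nth f k"

definition dilated_hankel :: "nat \<Rightarrow> 'a :: comm_ring_1 fps \<Rightarrow> 'a" where
  "dilated_hankel n f = det (mat n n (\<lambda>(i, j). egf_coeff f (2 * i + j)))"

text \<open>
  The power \<open>g\<^sup>a\<close> of a formal power series with constant coefficient 1 and an arbitrary exponent
  \<open>a\<close>, as the binomial series \<open>(1 + u)\<^sup>a = (\<Sum>k. (a gchoose k) u\<^sup>k)\<close> at \<open>u = g - 1\<close>.
  It has no mathematical meaning for other constant coefficients.
\<close>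
definition fps_gpower :: "'a :: field_char_0 fps \<Rightarrow> 'a \<Rightarrow> 'a fps" where
  "fps_gpower g a = fps_compose (fps_binomial a) (g - 1)"

lemma fps_gpower_of_nat:
  assumes "fps_nth g 0 = 1"
  shows "fps_gpower g (of_nat m) = g ^ m"
proof -
  have "fps_nth (g - 1) 0 = 0"
    using assms by simp
  then show ?thesis
    unfolding fps_gpower_def fps_binomial_of_nat
    by (simp add: fps_compose_power [symmetric] fps_compose_add_distrib)
qed

definition cos_series :: "'a :: field_char_0 \<Rightarrow> 'a fps" where
  "cos_series s = (1 + fps_X) / fps_gpower (fps_cos 1) (s + 1)"

fun double_fact :: "nat \<Rightarrow> nat" where
  "double_fact 0 = 1"
| "double_fact (Suc 0) = 1"
| "double_fact (Suc (Suc m)) = Suc (Suc m) * double_fact m"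

text \<open>
  For \<open>n = 1\<close> the truncated subtraction \<open>n - 2 = 0\<close> is harmless: the range \<open>{1..n - 2}\<close> is empty
  as intended.
\<close>
definition hankel_const :: "nat \<Rightarrow> 'a :: field_char_0" where
  "hankel_const n =
     2 ^ (n choose 2) * of_nat (double_fact (n - 1)) ^ 2 *
     (\<Prod>k = 1..n - 2. of_nat (double_fact k) ^ 6) / (\<Prod>i = 1..n - 1. fact i)"

end

theory Submission
  imports Defs
begin

no_notation vec_index (infixl "$" 100)
unbundle fps_syntax

text \<open>
  Put \<open>r = s + 1\<close>, \<open>g = 1 / cos(x)\<^sup>r\<close> and \<open>t = tan x\<close>. The \<open>j\<close>-th derivative of \<open>g\<close> is \<open>g\<close> times a
  polynomial in \<open>t\<close> of degree \<open>j\<close>, of the parity of \<open>j\<close>, with leading coefficient \<open>r (r + 1) \<dots> (r + j - 1)\<close>.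
  As \<open>g\<close> is even, column \<open>j\<close> of the Hankel matrix only sees the even part of the \<open>j\<close>-th derivative of
  \<open>(1 + x) g\<close>, and this is \<open>g\<close> times a combination of \<open>C\<^sub>k = t\<^sup>k\<close> (\<open>k\<close> even) and \<open>C\<^sub>k = x t\<^sup>k\<close> (\<open>k\<close> odd)
  with \<open>k \<le> j\<close>. So the Hankel matrix is \<open>N U\<close> with \<open>U\<close> upper triangular and \<open>N\<close> made of the even
  coefficients of \<open>g C\<^sub>k\<close>; the parameter enters the determinant only through the diagonal of \<open>U\<close>.
  Since \<open>x = arctan t\<close>, the remainders in the Pade approximation of \<open>arctan\<close> (Gauss' continued fraction)
  are unitriangular combinations of the \<open>C\<^sub>k\<close> which vanish to order \<open>2 j\<close>, and they bring \<open>N\<close> to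
  lower triangular form.
\<close>

section \<open>Determinants of triangular matrices and of products\<close>

lemma det_upper_triangular_mat:
  fixes u :: "nat \<Rightarrow> nat \<Rightarrow> 'a :: comm_ring_1"
  assumes "\<And>i j. j < i \<Longrightarrow> i < n \<Longrightarrow> u i j = 0"
  shows "det (mat n n (\<lambda>(i, j). u i j)) = (\<Prod>i<n. u i i)"
  by (subst det_upper_triangular[of _ n])
    (use assms in \<open>auto simp: prod_list_diag_prod atLeast0LessThan\<close>)

lemma det_lower_triangular_mat:
  fixes u :: "nat \<Rightarrow> nat \<Rightarrow> 'a :: comm_ring_1"
  assumes "\<And>i j. i < j \<Longrightarrow> j < n \<Longrightarrow> u i j = 0"
  shows "det (mat n n (\<lambda>(i, j). u i j)) = (\<Prod>i<n. u i i)"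
proof -
  have "det (mat n n (\<lambda>(i, j). u i j)) = prod_list (diag_mat (mat n n (\<lambda>(i, j). u i j)))"
    by (rule det_lower_triangular[of n]) (use assms in auto)
  then show ?thesis
    by (simp add: prod_list_diag_prod atLeast0LessThan)
qed

lemma det_mult_mat:
  fixes a b :: "nat \<Rightarrow> nat \<Rightarrow> 'a :: comm_ring_1"
  shows "det (mat n n (\<lambda>(i, j). \<Sum>k<n. a i k * b k j)) =
    det (mat n n (\<lambda>(i, j). a i j)) * det (mat n n (\<lambda>(i, j). b i j))"
proof -
  have "mat n n (\<lambda>(i, j). \<Sum>k<n. a i k * b k j) =
      mat n n (\<lambda>(i, j). a i j) * mat n n (\<lambda>(i, j). b i j)"
    by (intro eq_matI) (auto simp: scalar_prod_def atLeast0LessThan)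
  then show ?thesis
    by (simp add: det_mult[of _ n])
qed

section \<open>Powers of the secant and their derivatives\<close>

text \<open>This is \<open>1 / cos(x)^r\<close>. With the exponent \<open>- r\<close> inside the
  binomial series the chain rule applies directly, and every coefficient is visibly polynomial in
  \<open>r\<close>.\<close>

definition sec_power :: "'a :: field_char_0 \<Rightarrow> 'a fps" where
  "sec_power r = fps_binomial (- r) oo (fps_cos 1 - 1)"

lemma one_plus_X_compose_cos: "(1 + fps_X) oo (fps_cos 1 - 1) = (fps_cos 1 :: 'a :: field_char_0 fps)"
  by (simp add: fps_compose_add_distrib)

lemma cos_series_eq: "cos_series s = (1 + fps_X) * sec_power (s + 1)"
proof -
  have "fps_binomial (- (s + 1)) * fps_binomial (s + 1) = 1"
    by (simp flip: fps_binomial_add_mult)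
  then have "fps_binomial (- (s + 1)) = inverse (fps_binomial (s + 1))"
    by (metis fps_inverse_unique mult.commute)
  then have "sec_power (s + 1) = inverse (fps_gpower (fps_cos 1) (s + 1))"
    unfolding sec_power_def fps_gpower_def by (simp add: fps_inverse_compose)
  then show ?thesis
    by (simp add: cos_series_def fps_gpower_def fps_divide_unit)
qed

lemma sec_power_nth_0 [simp]: "sec_power r $ 0 = 1"
  by (simp add: sec_power_def)

lemma fps_tan_nth_0 [simp]: "(fps_tan c :: 'a :: field_char_0 fps) $ 0 = 0"
  by (simp add: fps_tan_def fps_divide_unit)

lemma fps_tan_deriv_1: "fps_deriv (fps_tan 1) = 1 + (fps_tan 1 :: 'a :: field_char_0 fps)\<^sup>2"
proof -
  let ?c = "fps_cos (1 :: 'a)" and ?s = "fps_sin (1 :: 'a)"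
  have ic: "inverse ?c * ?c = 1"
    by (rule inverse_mult_eq_1) simp
  have "fps_deriv (fps_tan 1) = inverse (?c\<^sup>2)"
    by (simp add: fps_tan_deriv fps_divide_unit fps_nth_power_0)
  also have "\<dots> = (inverse ?c)\<^sup>2 * (?c\<^sup>2 + ?s\<^sup>2)"
    by (simp add: fps_inverse_power fps_sin_cos_sum_of_squares)
  also have "\<dots> = (inverse ?c * ?c)\<^sup>2 + (?s * inverse ?c)\<^sup>2"
    by (simp add: algebra_simps power_mult_distrib)
  finally show ?thesis
    by (simp add: ic fps_tan_def fps_divide_unit)
qed

lemma sec_power_deriv: "fps_deriv (sec_power r) = fps_const r * fps_tan 1 * sec_power r"
proof -
  have "fps_deriv (sec_power r) =
      ((fps_const (- r) * fps_binomial (- r) / (1 + fps_X)) oo (fps_cos 1 - 1)) * - fps_sin 1"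
    unfolding sec_power_def
    by (subst fps_compose_deriv) (simp_all add: fps_binomial_deriv fps_cos_deriv flip: fps_const_neg)
  also have "(fps_const (- r) * fps_binomial (- r) / (1 + fps_X)) oo (fps_cos 1 - 1)
      = (fps_const (- r) * sec_power r) * inverse (fps_cos 1)"
    by (simp add: fps_divide_unit fps_compose_mult_distrib fps_inverse_compose
        one_plus_X_compose_cos sec_power_def del: fps_const_neg)
  finally show ?thesis
    by (simp add: fps_tan_def fps_divide_unit mult_ac flip: fps_const_neg)
qed

lemma fps_odd_nth_power_zero:
  fixes f :: "'a :: comm_ring_1 fps"
  assumes "\<And>n. odd n \<Longrightarrow> f $ n = 0" and "odd n"
  shows "f ^ k $ n = 0"
  using \<open>odd n\<close>
proof (induction k arbitrary: n)
  case (Suc k)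
  have "f $ i * f ^ k $ (n - i) = 0" if "i \<le> n" for i
    using Suc.prems that assms(1)[of i] Suc.IH[of "n - i"] by (cases "odd i") auto
  then show ?case
    by (simp add: fps_mult_nth)
qed (simp add: odd_pos)

lemma sec_power_nth_odd:
  assumes "odd n"
  shows "sec_power r $ n = 0"
proof -
  have "(fps_cos 1 - 1 :: 'a fps) $ m = 0" if "odd m" for m
    using that by (simp add: fps_cos_def odd_pos)
  then show ?thesis
    using assms by (simp add: sec_power_def fps_compose_nth fps_odd_nth_power_zero odd_pos)
qed

text \<open>The coefficient of \<open>t^k\<close> in the \<open>j\<close>-th derivative of
  \<open>g\<close>, divided by \<open>g\<close>. From \<open>g' = r t g\<close> and
  \<open>t' = 1 + t^2\<close>, the derivative of \<open>g t^k\<close> is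
  \<open>g ((r + k) t^(k+1) + k t^(k-1))\<close>; the recursion collects these terms.\<close>

fun sec_deriv_coeff :: "'a :: comm_ring_1 \<Rightarrow> nat \<Rightarrow> nat \<Rightarrow> 'a" where
  "sec_deriv_coeff r 0 k = (if k = 0 then 1 else 0)"
| "sec_deriv_coeff r (Suc j) k =
     (if k = 0 then 0 else (r + of_nat (k - 1)) * sec_deriv_coeff r j (k - 1)) +
     of_nat (Suc k) * sec_deriv_coeff r j (Suc k)"

lemma sec_deriv_coeff_eq_0: "k > j \<Longrightarrow> sec_deriv_coeff r j k = 0"
  by (induction j arbitrary: k) auto

lemma sec_deriv_coeff_odd: "odd (j + k) \<Longrightarrow> sec_deriv_coeff r j k = 0"
  by (induction j arbitrary: k) (auto simp: odd_pos)

lemma sec_deriv_coeff_diag: "sec_deriv_coeff r j j = pochhammer r j"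
  by (induction j) (simp_all add: sec_deriv_coeff_eq_0 pochhammer_Suc mult.commute)

lemma fps_nth_deriv_sec_power:
  "fps_nth_deriv j (sec_power r) =
     sec_power r * (\<Sum>k\<le>j. fps_const (sec_deriv_coeff r j k) * fps_tan 1 ^ k)"
proof (induction j)
  case (Suc j)
  let ?t = "fps_tan (1 :: 'a)" and ?c = "\<lambda>k. fps_const (sec_deriv_coeff r j k)"
  have deriv_term: "fps_deriv (sec_power r * (?c k * ?t ^ k)) =
      sec_power r * (?c k * fps_const (r + of_nat k) * ?t ^ Suc k + of_nat k * ?c k * ?t ^ (k - 1))"
    for k
  proof -
    \<comment> \<open>At \<open>k = 0\<close> the truncated exponent is harmless, since both sides
      carry the factor 0.\<close>
    have t: "of_nat k * (?t ^ (k - 1) * ?t\<^sup>2) = of_nat k * ?t ^ Suc k"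
      by (cases k) (simp_all add: power2_eq_square mult_ac)
    have "fps_deriv (sec_power r * (?c k * ?t ^ k)) =
        sec_power r * ?c k * (fps_const r * ?t ^ Suc k + of_nat k * ?t ^ (k - 1)
          + of_nat k * (?t ^ (k - 1) * ?t\<^sup>2))"
      by (simp add: fps_deriv_power' sec_power_deriv fps_tan_deriv_1 algebra_simps del: fps_const_mult)
    then show ?thesis
      unfolding t by (simp add: algebra_simps fps_of_nat[symmetric] flip: fps_const_add del: fps_const_mult)
  qed
  have "fps_nth_deriv (Suc j) (sec_power r) =
      (\<Sum>k\<le>j. fps_deriv (sec_power r * (?c k * ?t ^ k)))"
    unfolding fps_nth_deriv_commute Suc.IH sum_distrib_left fps_deriv_sum ..
  also have "\<dots> = sec_power r * ((\<Sum>k\<le>j. ?c k * fps_const (r + of_nat k) * ?t ^ Suc k) +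
      (\<Sum>k\<le>j. of_nat k * ?c k * ?t ^ (k - 1)))"
    unfolding deriv_term by (simp add: sum_distrib_left sum.distrib distrib_left)
  also have "(\<Sum>k\<le>j. of_nat k * ?c k * ?t ^ (k - 1)) =
      (\<Sum>k\<le>Suc j. of_nat (Suc k) * ?c (Suc k) * ?t ^ k)"
  proof -
    \<comment> \<open>The two added terms vanish for degree reasons; the shift then drops
      \<open>k = 0\<close>, which has the factor 0.\<close>
    have "(\<Sum>k\<le>j. of_nat k * ?c k * ?t ^ (k - 1)) =
        (\<Sum>k\<le>Suc (Suc j). of_nat k * ?c k * ?t ^ (k - 1))"
      by (simp add: sec_deriv_coeff_eq_0)
    also have "\<dots> = (\<Sum>k\<le>Suc j. of_nat (Suc k) * ?c (Suc k) * ?t ^ k)"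
      by (subst sum.atMost_Suc_shift) simp
    finally show ?thesis .
  qed
  also have "(\<Sum>k\<le>j. ?c k * fps_const (r + of_nat k) * ?t ^ Suc k) =
      (\<Sum>k\<le>Suc j. fps_const (if k = 0 then 0 else
         (r + of_nat (k - 1)) * sec_deriv_coeff r j (k - 1)) * ?t ^ k)"
    by (simp add: sum.atMost_Suc_shift mult_ac del: sum.atMost_Suc)
  finally show ?case
    by (simp add: sum.distrib[symmetric] algebra_simps fps_of_nat[symmetric]
        flip: fps_const_add fps_const_mult del: sum.atMost_Suc)
qed simp

section \<open>Factorization of the Hankel matrix\<close>

lemma egf_coeff_deriv: "egf_coeff (fps_deriv f) k = egf_coeff f (Suc k)"
  by (simp add: egf_coeff_def algebra_simps)

lemma egf_coeff_nth_deriv: "egf_coeff (fps_nth_deriv j f) k = egf_coeff f (k + j)"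
  by (induction j arbitrary: f) (simp_all add: egf_coeff_deriv)

lemma egf_coeff_X_mult:
  "egf_coeff (fps_X * f) k = (of_nat k * egf_coeff f (k - 1) :: 'a :: comm_ring_1)"
  by (cases k) (simp_all add: egf_coeff_def algebra_simps)

lemma egf_coeff_add: "egf_coeff (f + g) k = egf_coeff f k + egf_coeff g k"
  by (simp add: egf_coeff_def algebra_simps)

lemma egf_coeff_cmult:
  "egf_coeff (fps_const c * f) k = (c * egf_coeff f k :: 'a :: comm_ring_1)"
  by (simp add: egf_coeff_def algebra_simps)

lemma egf_coeff_sum: "egf_coeff (sum f A) k = (\<Sum>x\<in>A. egf_coeff (f x) k)"
  by (simp add: egf_coeff_def fps_sum_nth sum_distrib_left)

definition padded_tan_power :: "nat \<Rightarrow> 'a :: field_char_0 fps" where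
  "padded_tan_power k = (if even k then 1 else fps_X) * fps_tan 1 ^ k"

text \<open>The entries of \<open>U\<close>. By Leibniz the \<open>j\<close>-th derivative of
  \<open>(1 + x) g\<close> is \<open>g^(j) + x g^(j) + j g^(j-1)\<close>; its even part is
  \<open>g^(j)\<close> for even \<open>j\<close> and the other two terms for odd
  \<open>j\<close>.\<close>

definition column_coeff :: "'a :: comm_ring_1 \<Rightarrow> nat \<Rightarrow> nat \<Rightarrow> 'a" where
  "column_coeff r k j = sec_deriv_coeff r j k +
     (if odd j then of_nat j * sec_deriv_coeff r (j - 1) k else 0)"

lemma column_coeff_eq_0: "j < k \<Longrightarrow> column_coeff r k j = 0"
  by (simp add: column_coeff_def sec_deriv_coeff_eq_0)

lemma column_coeff_diag: "column_coeff r j j = pochhammer r j"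
  by (cases j) (simp_all add: column_coeff_def sec_deriv_coeff_eq_0 sec_deriv_coeff_diag
      del: sec_deriv_coeff.simps)

text \<open>Coefficients with \<open>j + k\<close> odd vanish, so \<open>C\<close> has to be known
  for one parity only. This covers \<open>padded_tan_power\<close> with \<open>h = 1\<close> as well
  as with \<open>h = fps_X\<close>.\<close>

lemma sec_deriv_sum:
  assumes "\<And>k. k \<le> n \<Longrightarrow> even (j + k) \<Longrightarrow> C k = fps_tan 1 ^ k * h" and "j \<le> n"
  shows "sec_power r * (\<Sum>k\<le>n. fps_const (sec_deriv_coeff r j k) * C k) =
      h * fps_nth_deriv j (sec_power r)"
proof -
  have "(\<Sum>k\<le>n. fps_const (sec_deriv_coeff r j k) * C k) =
      (\<Sum>k\<le>n. fps_const (sec_deriv_coeff r j k) * (fps_tan 1 ^ k * h))"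
    using assms(1) by (intro sum.cong refl) (metis fps_const_0_eq_0 mult_zero_left sec_deriv_coeff_odd atMost_iff)
  also have "\<dots> = (\<Sum>k\<le>j. fps_const (sec_deriv_coeff r j k) * (fps_tan 1 ^ k * h))"
    by (rule sum.mono_neutral_right) (use assms(2) in \<open>auto simp: sec_deriv_coeff_eq_0\<close>)
  finally show ?thesis
    by (simp add: fps_nth_deriv_sec_power sum_distrib_left mult_ac)
qed

text \<open>Multiplying by \<open>1 + x\<close> gives two terms on the left, with adjacent indices;
  as \<open>g\<close> is even, the parity of \<open>j\<close> decides which one survives.\<close>

lemma egf_coeff_cos_series:
  "egf_coeff (cos_series s) (2 * i + j) =
     egf_coeff (sec_power (s + 1) * (\<Sum>k\<le>j. fps_const (column_coeff (s + 1) k j) * padded_tan_power k))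
       (2 * i)"
proof -
  let ?r = "s + 1"
  let ?g = "sec_power ?r"
  have odd0: "egf_coeff ?g k = 0" if "odd k" for k
    using that by (simp add: egf_coeff_def sec_power_nth_odd)
  have lhs: "egf_coeff (cos_series s) (2 * i + j) =
      egf_coeff ?g (2 * i + j) + of_nat (2 * i + j) * egf_coeff ?g (2 * i + j - 1)"
    by (simp add: cos_series_eq distrib_right egf_coeff_add egf_coeff_X_mult)
  show ?thesis
  proof (cases "even j")
    case True
    have "?g * (\<Sum>k\<le>j. fps_const (column_coeff ?r k j) * padded_tan_power k) =
        ?g * (\<Sum>k\<le>j. fps_const (sec_deriv_coeff ?r j k) * padded_tan_power k)"
      using True by (simp add: column_coeff_def)
    also have "\<dots> = 1 * fps_nth_deriv j ?g"
      by (rule sec_deriv_sum) (use True in \<open>auto simp: padded_tan_power_def\<close>)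
    finally have "egf_coeff (?g * (\<Sum>k\<le>j. fps_const (column_coeff ?r k j) * padded_tan_power k)) (2 * i)
        = egf_coeff ?g (2 * i + j)"
      by (simp add: egf_coeff_nth_deriv)
    moreover have "of_nat (2 * i + j) * egf_coeff ?g (2 * i + j - 1) = 0"
      using True odd0[of "2 * i + j - 1"] by (cases "2 * i + j = 0") auto
    ultimately show ?thesis
      using lhs by simp
  next
    case False
    have "?g * (\<Sum>k\<le>j. fps_const (column_coeff ?r k j) * padded_tan_power k) =
        ?g * (\<Sum>k\<le>j. fps_const (sec_deriv_coeff ?r j k) * padded_tan_power k) +
        fps_const (of_nat j) *
          (?g * (\<Sum>k\<le>j. fps_const (sec_deriv_coeff ?r (j - 1) k) * padded_tan_power k))"
      using False by (simp add: column_coeff_def sum.distrib sum_distrib_left algebra_simps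
          flip: fps_const_add fps_const_mult)
    also have "?g * (\<Sum>k\<le>j. fps_const (sec_deriv_coeff ?r j k) * padded_tan_power k) =
        fps_X * fps_nth_deriv j ?g"
      by (rule sec_deriv_sum) (use False in \<open>auto simp: padded_tan_power_def\<close>)
    also have "?g * (\<Sum>k\<le>j. fps_const (sec_deriv_coeff ?r (j - 1) k) * padded_tan_power k) =
        1 * fps_nth_deriv (j - 1) ?g"
      by (rule sec_deriv_sum) (use False in \<open>auto simp: padded_tan_power_def\<close>)
    finally have rhs: "egf_coeff (?g * (\<Sum>k\<le>j. fps_const (column_coeff ?r k j) * padded_tan_power k)) (2 * i)
        = of_nat (2 * i) * egf_coeff ?g (2 * i - 1 + j) + of_nat j * egf_coeff ?g (2 * i + (j - 1))"
      by (simp add: egf_coeff_add egf_coeff_X_mult egf_coeff_cmult egf_coeff_nth_deriv)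
    \<comment> \<open>The two indices differ only at \<open>i = 0\<close>, where the factor is 0.
      The weights \<open>2 * i\<close> and \<open>j\<close> then add up to the factor in
      \<open>lhs\<close>.\<close>
    have "of_nat (2 * i) * egf_coeff ?g (2 * i - 1 + j) = of_nat (2 * i) * egf_coeff ?g (2 * i + j - 1)"
      by (cases i) simp_all
    moreover have "2 * i + (j - 1) = 2 * i + j - 1"
      using False by (cases j) simp_all
    moreover have "egf_coeff ?g (2 * i + j) = 0"
      using False by (intro odd0) simp
    ultimately show ?thesis
      unfolding lhs rhs by (simp only: of_nat_add distrib_right add_0)
  qed
qed


section \<open>Gauss' continued fraction for the arctangent\<close>

text \<open>
  \<open>hankel_pivot j\<close> is the ratio of \<open>hankel_const (j + 1)\<close> and \<open>hankel_const j\<close>; divided by \<open>(2 j)!\<close> it is the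
  leading coefficient of the \<open>j\<close>-th remainder. The truncated \<open>0 - 1\<close> is harmless, as \<open>0!! = (-1)!!\<close>.
\<close>
definition hankel_pivot :: "nat \<Rightarrow> 'a :: field_char_0" where
  "hankel_pivot j = 2 ^ j * fact j * of_nat (double_fact (j - 1)) ^ 2"

text \<open>The coefficients of the hypergeometric series \<open>F(j/2, (j+1)/2; j + 1/2; - z)\<close>.\<close>
definition gauss_coeff :: "nat \<Rightarrow> nat \<Rightarrow> 'a :: field_char_0" where
  "gauss_coeff j m = (- 1) ^ m * pochhammer (of_nat j) (2 * m) /
     (4 ^ m * fact m * pochhammer (of_nat j + 1 / 2) m)"

text \<open>The Pade remainders in closed form, as \<open>z^(2 j)\<close> times a scaled
  hypergeometric series in \<open>- z^2\<close>. The order of vanishing is then immediate, and the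
  recurrence becomes an identity of coefficients.\<close>

definition arctan_remainder :: "nat \<Rightarrow> 'a :: field_char_0 fps" where
  "arctan_remainder j = Abs_fps (\<lambda>n. if even n \<and> 2 * j \<le> n
     then hankel_pivot j / fact (2 * j) * gauss_coeff j (n div 2 - j) else 0)"

lemma double_fact_pos: "double_fact n > 0"
  by (induction n rule: double_fact.induct) auto

lemma fact_eq_double_fact: "fact (Suc n) = double_fact (Suc n) * double_fact n"
  by (induction n) (simp_all add: algebra_simps)

lemma hankel_pivot_nonzero: "(hankel_pivot j :: 'a :: field_char_0) \<noteq> 0"
  using double_fact_pos[of "j - 1"] by (simp add: hankel_pivot_def)

lemma of_nat_plus_half_nonzero:
  "(of_nat q :: 'a :: field_char_0) + 1 / 2 \<noteq> 0" "(of_nat q :: 'a) + 3 / 2 \<noteq> 0"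
proof -
  have "(of_nat (Suc (2 * q)) :: 'a) \<noteq> 0" "(of_nat (Suc (2 * q) + 2) :: 'a) \<noteq> 0"
    unfolding of_nat_eq_0_iff by simp_all
  then show "(of_nat q :: 'a) + 1 / 2 \<noteq> 0" "(of_nat q :: 'a) + 3 / 2 \<noteq> 0"
    by (auto simp: field_simps)
qed

lemma pochhammer_half_nonzero: "pochhammer ((of_nat q :: 'a :: field_char_0) + 1 / 2) m \<noteq> 0"
proof
  assume "pochhammer ((of_nat q :: 'a) + 1 / 2) m = 0"
  then obtain k where "(of_nat q :: 'a) + 1 / 2 = - of_nat k"
    by (auto simp: pochhammer_eq_0_iff)
  then have "(of_nat (q + k) :: 'a) + 1 / 2 = 0"
    by (simp add: algebra_simps)
  then show False
    using of_nat_plus_half_nonzero(1)[of "q + k"] by contradiction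
qed

text \<open>The last factor is the one in \<open>gauss_coeff_rec\<close>; this match of
  normalizations lets the recurrence of the remainders close up.\<close>

lemma hankel_pivot_rec:
  "(hankel_pivot (q + 2) / fact (2 * (q + 2)) :: 'a :: field_char_0) =
     hankel_pivot q / fact (2 * q) * ((of_nat q + 1)\<^sup>2 / (4 * (of_nat q + 1 / 2) * (of_nat q + 3 / 2)))"
proof -
  have df: "of_nat (double_fact (q + 1)) = (of_nat q + 1 :: 'a) * of_nat (double_fact (q - 1))"
    by (cases q) (simp_all add: distrib_right)
  have "2 * (q + 2) = Suc (Suc (Suc (Suc (2 * q))))"
    by simp
  then have "(fact (2 * (q + 2)) :: 'a) = of_nat (Suc (Suc (Suc (Suc (2 * q))))) *
      (of_nat (Suc (Suc (Suc (2 * q)))) * (of_nat (Suc (Suc (2 * q))) * (of_nat (Suc (2 * q)) * fact (2 * q))))"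
    by (simp only: fact_Suc)
  then have f: "(fact (2 * (q + 2)) :: 'a) = (2 * of_nat q + 1) * (2 * (of_nat q + 1)) *
      (2 * of_nat q + 3) * (2 * (of_nat q + 2)) * fact (2 * q)"
    by (simp add: algebra_simps)
  have "q + 2 = Suc (Suc q)"
    by simp
  then have f': "(fact (q + 2) :: 'a) = (of_nat q + 1) * (of_nat q + 2) * fact q"
    by (simp only: fact_Suc) (simp add: algebra_simps)
  have nz: "(2 * of_nat q + 1 :: 'a) \<noteq> 0" "(2 * of_nat q + 3 :: 'a) \<noteq> 0"
    "(of_nat q + 1 :: 'a) \<noteq> 0" "(of_nat q + 2 :: 'a) \<noteq> 0"
    using of_nat_plus_half_nonzero[of q, where ?'a = 'a] of_nat_neq_0[of q, where ?'a = 'a]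
      of_nat_neq_0[of "Suc q", where ?'a = 'a]
    by (auto simp: field_simps)
  have half: "(of_nat q + 1 / 2 :: 'a) = (2 * of_nat q + 1) / 2" "(of_nat q + 3 / 2 :: 'a) = (2 * of_nat q + 3) / 2"
    by (simp_all add: field_simps)
  \<comment> \<open>Here \<open>a\<close>, \<open>b\<close>, \<open>c\<close>, \<open>e\<close>
    stand for \<open>2 q + 1\<close>, \<open>2 q + 3\<close>, \<open>q + 1\<close>,
    \<open>q + 2\<close>; \<open>d\<close> is the double factorial, \<open>p = 2^q\<close>,
    \<open>F = q!\<close> and \<open>G = (2 q)!\<close>.\<close>
  have cancel: "4 * p * (c * e * F) * (c * d)\<^sup>2 / (a * (2 * c) * b * (2 * e) * G) =
      p * F * d\<^sup>2 / G * (c\<^sup>2 / (4 * (a / 2) * (b / 2)))"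
    if "a \<noteq> 0" "b \<noteq> 0" "c \<noteq> 0" "e \<noteq> 0" "G \<noteq> 0" for a b c d e p F G :: 'a
    using that by (simp add: field_simps power2_eq_square)
  have pow: "(2 ^ (q + 2) :: 'a) = 4 * 2 ^ q"
    by simp
  have "q + 2 - 1 = q + 1"
    by simp
  then show ?thesis
    unfolding hankel_pivot_def by (simp only: f f' half df pow cancel nz fact_nonzero not_False_eq_True)
qed

lemma gauss_coeff_0 [simp]: "gauss_coeff j 0 = 1"
  by (simp add: gauss_coeff_def)

text \<open>Gauss' contiguous relation \<open>F(a,b;c) - F(a,b+1;c+1) = - a (c-b) / (c (c+1)) z
  F(a+1,b+1;c+2)\<close> for \<open>a = (q+1)/2\<close>, \<open>b = q/2\<close>,
  \<open>c = q + 1/2\<close>, with \<open>- z\<close> for \<open>z\<close>.\<close>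

lemma gauss_coeff_rec:
  "(gauss_coeff q (Suc m) :: 'a :: field_char_0) = gauss_coeff (q + 1) (Suc m) +
     (of_nat q + 1)\<^sup>2 / (4 * (of_nat q + 1 / 2) * (of_nat q + 3 / 2)) * gauss_coeff (q + 2) m"
proof -
  define x z :: 'a where "x = of_nat q" and "z = of_nat m"
  define P Y where "P = pochhammer (x + 2) (2 * m)" and "Y = pochhammer (x + 5 / 2) m"
  \<comment> \<open>\<open>G\<close> is \<open>gauss_coeff (q + 2) m\<close>; the other two
    coefficients are rational multiples of it, which leaves the polynomial identity
    \<open>num\<close>.\<close>
  define G where "G = (- 1) ^ m * P / (4 ^ m * fact m * Y)"
  note nz1 = of_nat_plus_half_nonzero(1,2)[of q, where ?'a = 'a, folded x_def]
  have nz2: "z + 1 \<noteq> 0"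
    using of_nat_neq_0[of m, where ?'a = 'a] by (simp add: z_def add.commute)
  have nz3: "x + z + 3 / 2 \<noteq> 0"
    using of_nat_plus_half_nonzero(2)[of "q + m", where ?'a = 'a] by (simp add: x_def z_def)
  have nzY: "Y \<noteq> 0"
    using pochhammer_half_nonzero[of "q + 2" m, where ?'a = 'a] by (simp add: Y_def x_def add_ac)
  have P1: "pochhammer x (2 * Suc m) = x * (x + 1) * P"
    by (simp add: P_def pochhammer_rec add_ac)
  have "pochhammer (x + 1) (Suc (Suc (2 * m))) = (x + 1) * pochhammer (x + 1 + 1) (Suc (2 * m))"
    by (rule pochhammer_rec)
  then have P2: "pochhammer (x + 1) (2 * Suc m) = (x + 1) * P * (x + 2 + 2 * z)"
    by (simp add: P_def z_def pochhammer_Suc add.assoc)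
  have Y2: "pochhammer (x + 3 / 2) (Suc m) = (x + 3 / 2) * Y"
    by (simp add: Y_def pochhammer_rec add_ac)
  have "x + 1 / 2 + 1 = x + 3 / 2"
    by simp
  then have "pochhammer (x + 1 / 2) (Suc m) = (x + 1 / 2) * pochhammer (x + 3 / 2) m"
    by (simp only: pochhammer_rec)
  then have "pochhammer (x + 1 / 2) (Suc m) * (x + z + 3 / 2) =
      (x + 1 / 2) * pochhammer (x + 3 / 2) (Suc m)"
    by (simp add: pochhammer_Suc z_def add_ac)
  then have Y1: "pochhammer (x + 1 / 2) (Suc m) = (x + 1 / 2) * (x + 3 / 2) * Y / (x + z + 3 / 2)"
    using nz3 unfolding Y2 by (simp add: eq_divide_eq mult.assoc)
  have "gauss_coeff q (Suc m) = (- 1) ^ Suc m * (x * (x + 1) * P) /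
      (4 ^ Suc m * ((z + 1) * fact m) * ((x + 1 / 2) * (x + 3 / 2) * Y / (x + z + 3 / 2)))"
    by (simp only: gauss_coeff_def x_def[symmetric] P1 Y1 fact_Suc of_nat_Suc z_def[symmetric]
        add.commute[of 1 z])
  then have g0: "gauss_coeff q (Suc m) = - G * x * (x + 1) * (x + z + 3 / 2) /
      (4 * (z + 1) * (x + 1 / 2) * (x + 3 / 2))"
    using nz1 nz2 nz3 nzY
    by (simp add: G_def mult_ac del: distrib_left_numeral distrib_right_numeral)
  have g1: "gauss_coeff (q + 1) (Suc m) = - G * (x + 1) * (x + 2 + 2 * z) /
      (4 * (z + 1) * (x + 3 / 2))"
  proof -
    have q: "of_nat (q + 1) = x + 1" "x + 1 + 1 / 2 = x + 3 / 2"
      by (simp_all add: x_def)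
    have "gauss_coeff (q + 1) (Suc m) = (- 1) ^ Suc m * ((x + 1) * P * (x + 2 + 2 * z)) /
        (4 ^ Suc m * ((z + 1) * fact m) * ((x + 3 / 2) * Y))"
      by (simp only: gauss_coeff_def q P2 Y2 fact_Suc of_nat_Suc z_def[symmetric] add.commute[of 1 z])
    then show ?thesis
      using nz1 nz2 nzY
      by (simp add: G_def mult_ac del: distrib_left_numeral distrib_right_numeral)
  qed
  have g2: "gauss_coeff (q + 2) m = G"
  proof -
    have q: "of_nat (q + 2) = x + 2" "x + 2 + 1 / 2 = x + 5 / 2"
      by (simp_all add: x_def)
    show ?thesis
      by (simp only: gauss_coeff_def G_def P_def Y_def q)
  qed
  have cancel: "- G * x * y * l / (4 * w * h * k) = - G * y * u / (4 * w * k) + y\<^sup>2 / (4 * h * k) * G"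
    if "h \<noteq> 0" "k \<noteq> 0" "w \<noteq> 0" and eq: "y\<^sup>2 * w = y * u * h - x * y * l" for y l w h k u
  proof -
    have "y\<^sup>2 / (4 * h * k) = (y\<^sup>2 * w) / (4 * w * h * k)"
      using that(1-3) by simp
    also have "\<dots> = (y * u * h - x * y * l) / (4 * w * h * k)"
      by (simp only: eq)
    finally have y: "y\<^sup>2 / (4 * h * k) = (y * u * h - x * y * l) / (4 * w * h * k)" .
    show ?thesis
      unfolding y using that(1-3) by (simp add: field_simps)
  qed
  have num: "(x + 1)\<^sup>2 * (z + 1) =
      (x + 1) * (x + 2 + 2 * z) * (x + 1 / 2) - x * (x + 1) * (x + z + 3 / 2)"
    by (simp add: field_simps power2_eq_square)
  show ?thesis
    unfolding x_def[symmetric] g0 g1 g2 by (rule cancel[OF nz1 nz2 num])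
qed

text \<open>The constant \<open>\<beta>\<close> is the ratio of leading coefficients, so the terms
  of order \<open>2 (q + 1)\<close> cancel; the higher ones are \<open>gauss_coeff_rec\<close>,
  scaled.\<close>

lemma arctan_remainder_rec:
  fixes q :: nat
  defines "\<beta> \<equiv> (hankel_pivot q / fact (2 * q)) / (hankel_pivot (q + 1) / fact (2 * (q + 1))) :: 'a :: field_char_0"
  shows "arctan_remainder (q + 2) = fps_X\<^sup>2 * arctan_remainder q - fps_const \<beta> * arctan_remainder (q + 1)"
proof (rule fps_ext)
  fix n
  let ?d = "\<lambda>j. hankel_pivot j / fact (2 * j) :: 'a"
  show "arctan_remainder (q + 2) $ n =
      (fps_X\<^sup>2 * arctan_remainder q - fps_const \<beta> * arctan_remainder (q + 1)) $ n"
  proof (cases "even n \<and> 2 * (q + 1) \<le> n")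
    case False
    then show ?thesis
      by (auto simp: arctan_remainder_def fps_X_power_mult_nth)
  next
    case True
    then obtain m where n: "n = 2 * (q + 1 + m)"
      by (metis dvd_def le_Suc_ex mult_le_cancel1 zero_less_numeral)
    have \<beta>: "\<beta> * ?d (q + 1) = ?d q"
    proof -
      have "?d (q + 1) \<noteq> 0"
        by (simp only: divide_eq_0_iff hankel_pivot_nonzero fact_nonzero simp_thms)
      then show ?thesis
        unfolding \<beta>_def by (rule nonzero_divide_eq_eq[THEN iffD1, OF _ refl, symmetric])
    qed
    have rhs: "(fps_X\<^sup>2 * arctan_remainder q - fps_const \<beta> * arctan_remainder (q + 1)) $ n =
        ?d q * gauss_coeff q m - (\<beta> * ?d (q + 1)) * gauss_coeff (q + 1) m"
      by (simp add: arctan_remainder_def fps_X_power_mult_nth n)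
    show ?thesis
    proof (cases m)
      case 0
      then show ?thesis
        unfolding rhs \<beta> by (simp add: arctan_remainder_def n)
    next
      case (Suc m')
      have "arctan_remainder (q + 2) $ n = ?d (q + 2) * gauss_coeff (q + 2) m'"
        by (simp add: arctan_remainder_def n Suc)
      then show ?thesis
        unfolding rhs \<beta> hankel_pivot_rec Suc gauss_coeff_rec[of q m']
        by (simp only: distrib_left add_diff_cancel_left' mult.assoc)
    qed
  qed
qed

section \<open>Substituting the tangent into the remainders\<close>

definition fps_arctan :: "'a :: field_char_0 fps" where
  "fps_arctan = Abs_fps (\<lambda>n. if odd n then (- 1) ^ (n div 2) / of_nat n else 0)"

lemma fps_arctan_compose_tan: "fps_arctan oo fps_tan 1 = (fps_X :: 'a :: field_char_0 fps)"
proof -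
  let ?t = "fps_tan (1 :: 'a)"
  have "(1 + fps_X\<^sup>2) * fps_deriv fps_arctan = (1 :: 'a fps)"
  proof (rule fps_ext)
    fix n
    have d: "fps_deriv fps_arctan $ n = (if even n then (- 1) ^ (n div 2) else 0 :: 'a)" for n
      using of_nat_neq_0[of n, where ?'a = 'a] by (auto simp: fps_arctan_def)
    show "((1 + fps_X\<^sup>2) * fps_deriv fps_arctan) $ n = (1 :: 'a fps) $ n"
      unfolding distrib_right mult_1_left fps_add_nth fps_X_power_mult_nth d
      \<comment> \<open>Only the split into \<open>0\<close>, \<open>1\<close> and
        \<open>Suc (Suc m)\<close> is wanted, because \<open>fps_X\<^sup>2\<close> shifts indices by
        two.\<close>
      by (cases n rule: double_fact.cases) simp_all
  qed
  then have "((1 + fps_X\<^sup>2) * fps_deriv fps_arctan) oo ?t = 1 oo ?t"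
    by simp
  then have "(1 + ?t\<^sup>2) * (fps_deriv fps_arctan oo ?t) = 1"
    by (simp add: fps_compose_mult_distrib fps_compose_add_distrib fps_X_power_compose)
  then have "fps_deriv (fps_arctan oo ?t) = fps_deriv fps_X"
    by (simp add: fps_compose_deriv fps_tan_deriv_1 mult.commute)
  then show ?thesis
    by (subst (asm) fps_deriv_eq_iff) (simp add: fps_arctan_def)
qed

lemma arctan_remainder_0: "arctan_remainder 0 = (1 :: 'a :: field_char_0 fps)"
proof (rule fps_ext)
  fix n
  have "gauss_coeff 0 m = (if m = 0 then 1 else 0 :: 'a)" for m
    by (cases m) (simp_all add: gauss_coeff_def pochhammer_rec)
  then show "arctan_remainder 0 $ n = (1 :: 'a fps) $ n"
    by (auto simp: arctan_remainder_def hankel_pivot_def elim!: evenE)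
qed

lemma arctan_remainder_1: "arctan_remainder 1 = (fps_X * fps_arctan :: 'a :: field_char_0 fps)"
proof (rule fps_ext)
  fix n
  \<comment> \<open>Both sides are \<open>(2 m + 1)!\<close>; the Pochhammer symbol belongs to the
    denominator of \<open>gauss_coeff 1 m\<close>.\<close>
  have fact_poch: "fact (2 * m) * (2 * of_nat m + 1) = (4 ^ m * fact m * pochhammer (3 / 2) m :: 'a)" for m
    by (induction m) (simp_all add: pochhammer_Suc field_simps)
  have "pochhammer (3 / 2 :: 'a) m \<noteq> 0" for m
    using pochhammer_half_nonzero[of 1 m, where ?'a = 'a] by simp
  moreover have "2 * of_nat m + 1 \<noteq> (0 :: 'a)" for m
    using of_nat_neq_0[of "2 * m", where ?'a = 'a] by (simp add: add.commute)
  ultimately have g: "gauss_coeff 1 m = ((- 1) ^ m / (2 * of_nat m + 1) :: 'a)" for m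
    unfolding gauss_coeff_def using fact_poch[of m] by (simp add: pochhammer_fact[symmetric] field_simps)
  show "arctan_remainder 1 $ n = (fps_X * fps_arctan :: 'a fps) $ n"
  proof (cases "even n \<and> n \<noteq> 0")
    case True
    then obtain m where "n = 2 * Suc m"
      by (metis evenE mult_0_right not0_implies_Suc)
    then show ?thesis
      using g[of m] by (simp add: arctan_remainder_def hankel_pivot_def fps_arctan_def)
  qed (auto simp: arctan_remainder_def fps_arctan_def)
qed

text \<open>The recurrence at \<open>z = tan x\<close>: the factor \<open>t^2\<close> sends
  \<open>C\<^sub>k\<close> to \<open>C\<^sub>k\<^sub>+\<^sub>2\<close>, so combinations stay inside
  the family and keep leading coefficient 1. It starts from \<open>1\<close> and
  \<open>x t\<close>.\<close>

lemma padded_tan_power_combination: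
  "\<exists>v. v j = 1 \<and> (\<forall>k>j. v k = 0) \<and>
     (\<Sum>k\<le>j. fps_const (v k) * padded_tan_power k) = arctan_remainder j oo fps_tan (1 :: 'a :: field_char_0)"
proof (induction j rule: induct_nat_012)
  case 0
  show ?case
    by (rule exI[of _ "\<lambda>k. of_bool (k = 0)"]) (simp add: arctan_remainder_0 padded_tan_power_def)
next
  case 1
  have "arctan_remainder (Suc 0) oo fps_tan 1 = fps_tan 1 * (fps_X :: 'a fps)"
    using arctan_remainder_1[where ?'a = 'a]
    by (simp add: fps_compose_mult_distrib fps_arctan_compose_tan)
  then show ?case
    by (intro exI[of _ "\<lambda>k. of_bool (k = 1)"]) (simp add: padded_tan_power_def mult.commute)
next
  case (ge2 q)
  let ?C = "padded_tan_power :: nat \<Rightarrow> 'a fps" and ?t = "fps_tan (1 :: 'a)"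
  define \<beta> where "\<beta> = (hankel_pivot q / fact (2 * q)) / (hankel_pivot (q + 1) / fact (2 * (q + 1)) :: 'a)"
  obtain v where v: "v q = 1" "\<And>k. k > q \<Longrightarrow> v k = 0"
    "(\<Sum>k\<le>q. fps_const (v k) * ?C k) = arctan_remainder q oo ?t"
    using ge2(1) by blast
  obtain w where w: "w (Suc q) = 1" "\<And>k. k > Suc q \<Longrightarrow> w k = 0"
    "(\<Sum>k\<le>Suc q. fps_const (w k) * ?C k) = arctan_remainder (Suc q) oo ?t"
    using ge2(2) by blast
  \<comment> \<open>As \<open>w\<close> ends at \<open>q + 1\<close>, the top coefficient
    \<open>u (q + 2)\<close> is \<open>v q = 1\<close>.\<close>
  define u where "u k = (if k < 2 then 0 else v (k - 2)) - \<beta> * w k" for k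
  have rec: "arctan_remainder (q + 2) =
      fps_X\<^sup>2 * arctan_remainder q - fps_const \<beta> * arctan_remainder (Suc q)"
    unfolding \<beta>_def Suc_eq_plus1 by (rule arctan_remainder_rec)
  have C2: "?C (Suc (Suc k)) = ?t\<^sup>2 * ?C k" for k
    by (simp add: padded_tan_power_def power2_eq_square)
  have "(\<Sum>k\<le>Suc (Suc q). fps_const (u k) * ?C k) =
      (\<Sum>k\<le>Suc (Suc q). fps_const (if k < 2 then 0 else v (k - 2)) * ?C k) -
      fps_const \<beta> * (\<Sum>k\<le>Suc (Suc q). fps_const (w k) * ?C k)"
    unfolding u_def by (simp only: sum_distrib_left sum_subtractf[symmetric] fps_const_sub[symmetric]
        fps_const_mult[symmetric] left_diff_distrib mult.assoc)
  also have "(\<Sum>k\<le>Suc (Suc q). fps_const (w k) * ?C k) = arctan_remainder (Suc q) oo ?t"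
    using w by simp
  also have "(\<Sum>k\<le>Suc (Suc q). fps_const (if k < 2 then 0 else v (k - 2)) * ?C k) =
      ?t\<^sup>2 * (\<Sum>k\<le>q. fps_const (v k) * ?C k)"
    by (simp add: sum.atMost_Suc_shift C2 sum_distrib_left mult_ac del: sum.atMost_Suc)
  also have "\<dots> = ?t\<^sup>2 * (arctan_remainder q oo ?t)"
    by (simp only: v)
  also have "?t\<^sup>2 * (arctan_remainder q oo ?t) - fps_const \<beta> * (arctan_remainder (Suc q) oo ?t) =
      arctan_remainder (q + 2) oo ?t"
    unfolding rec by (simp add: fps_compose_sub_distrib
        fps_compose_mult_distrib fps_X_power_compose)
  finally show ?case
    by (intro exI[of _ u]) (auto simp: u_def v w)
qed

text \<open>Since \<open>tan x = x + ...\<close>, the substitution preserves both the order of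
  vanishing and the leading coefficient.\<close>

lemma arctan_remainder_compose_tan_nth:
  assumes "m \<le> 2 * j"
  shows "(arctan_remainder j oo fps_tan 1) $ m =
    (if m = 2 * j then hankel_pivot j / fact (2 * j) else 0 :: 'a :: field_char_0)"
proof -
  have "fps_deriv (fps_tan 1) $ 0 = (1 + (fps_tan 1)\<^sup>2 :: 'a fps) $ 0"
    by (simp only: fps_tan_deriv_1)
  then have t1: "fps_tan 1 $ 1 = (1 :: 'a)"
    by (simp add: fps_nth_power_0)
  have "arctan_remainder j $ i = (0 :: 'a)" if "i < 2 * j" for i
    using that by (simp add: arctan_remainder_def)
  then have "(arctan_remainder j oo fps_tan 1) $ m =
      (\<Sum>i\<in>(if m = 2 * j then {2 * j} else {}). arctan_remainder j $ i * (fps_tan 1 ^ i $ m) :: 'a)"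
    unfolding fps_compose_nth using assms by (intro sum.mono_neutral_right) auto
  then show ?thesis
    using startsby_zero_power_nth_same[of "fps_tan (1 :: 'a)" "2 * j"] t1
    by (simp add: arctan_remainder_def)
qed

lemma egf_coeff_sec_power_mult_remainder:
  assumes "i \<le> j"
  shows "egf_coeff (sec_power r * (arctan_remainder j oo fps_tan 1)) (2 * i) =
    (if i = j then hankel_pivot j else 0 :: 'a :: field_char_0)"
proof -
  have "(sec_power r * (arctan_remainder j oo fps_tan 1)) $ (2 * i) =
      (\<Sum>k\<in>{0}. sec_power r $ k * (arctan_remainder j oo fps_tan 1) $ (2 * i - k))"
    unfolding fps_mult_nth using assms
    by (intro sum.mono_neutral_right) (auto simp: arctan_remainder_compose_tan_nth)
  then show ?thesis
    using assms by (simp add: egf_coeff_def arctan_remainder_compose_tan_nth)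
qed

lemma egf_coeff_mult_combination:
  "egf_coeff (g * (\<Sum>k\<in>A. fps_const (c k) * f k)) n =
     (\<Sum>k\<in>A. egf_coeff (g * f k) n * c k :: 'a :: comm_ring_1)"
proof -
  have "g * (\<Sum>k\<in>A. fps_const (c k) * f k) = (\<Sum>k\<in>A. fps_const (c k) * (g * f k))"
    by (simp add: sum_distrib_left mult_ac)
  then show ?thesis
    by (simp add: egf_coeff_sum egf_coeff_cmult mult.commute)
qed

section \<open>Evaluation of the determinant and of the constant\<close>

lemma sum_atMost_extend:
  fixes f :: "nat \<Rightarrow> 'a :: comm_monoid_add"
  assumes "j < n" "\<And>k. j < k \<Longrightarrow> f k = 0"
  shows "(\<Sum>k\<le>j. f k) = (\<Sum>k<n. f k)"
  by (rule sum.mono_neutral_left) (use assms in auto)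

lemma dilated_hankel_cos_series:
  fixes s :: "'a :: field_char_0"
  shows "dilated_hankel n (cos_series s) = (\<Prod>j<n. hankel_pivot j) * (\<Prod>j<n. pochhammer (s + 1) j)"
proof -
  let ?g = "sec_power (s + 1)"
  define N where "N i k = egf_coeff (?g * padded_tan_power k) (2 * i)" for i k
  \<comment> \<open>\<open>V j\<close> lists the coordinates of the \<open>j\<close>-th remainder,
    so it fills column \<open>j\<close> of a unitriangular matrix, and \<open>N\<close> times that
    matrix is lower triangular.\<close>
  obtain V where V: "\<And>j. V j j = (1 :: 'a)" "\<And>j k. j < k \<Longrightarrow> V j k = 0"
    "\<And>j. (\<Sum>k\<le>j. fps_const (V j k) * padded_tan_power k) = arctan_remainder j oo fps_tan 1"
    using padded_tan_power_combination[where ?'a = 'a] by metis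
  have NV: "(\<Sum>k<n. N i k * V j k) = egf_coeff (?g * (arctan_remainder j oo fps_tan 1)) (2 * i)"
    if "j < n" for i j
    unfolding V(3)[symmetric] N_def egf_coeff_mult_combination
    using that by (intro sum_atMost_extend[symmetric]) (auto simp: V)
  have "det (mat n n (\<lambda>(i, j). \<Sum>k<n. N i k * V j k)) = (\<Prod>j<n. hankel_pivot j)"
    by (subst det_lower_triangular_mat) (auto simp: NV egf_coeff_sec_power_mult_remainder)
  moreover have "det (mat n n (\<lambda>(k, j). V j k)) = 1"
    by (subst det_upper_triangular_mat) (auto simp: V)
  ultimately have detN: "det (mat n n (\<lambda>(i, k). N i k)) = (\<Prod>j<n. hankel_pivot j)"
    unfolding det_mult_mat by simp
  have "egf_coeff (cos_series s) (2 * i + j) = (\<Sum>k<n. N i k * column_coeff (s + 1) k j)"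
    if "j < n" for i j
    unfolding egf_coeff_cos_series N_def egf_coeff_mult_combination
    using that by (intro sum_atMost_extend) (auto simp: column_coeff_eq_0)
  then have "mat n n (\<lambda>(i, j). egf_coeff (cos_series s) (2 * i + j)) =
      mat n n (\<lambda>(i, j). \<Sum>k<n. N i k * column_coeff (s + 1) k j)"
    by (intro eq_matI) auto
  moreover have "det (mat n n (\<lambda>(k, j). column_coeff (s + 1) k j)) = (\<Prod>j<n. pochhammer (s + 1) j)"
    by (subst det_upper_triangular_mat) (auto simp: column_coeff_eq_0 column_coeff_diag)
  ultimately show ?thesis
    unfolding dilated_hankel_def by (simp add: det_mult_mat detN)
qed

text \<open>Passing from \<open>m + 1\<close> to \<open>m + 2\<close> multiplies the constant by
  \<open>2^(m+1) (m+1)!!^2 m!!^4 / (m+1)!\<close>, which is the pivot because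
  \<open>(m+1)! = (m+1)!! m!!\<close>.\<close>

lemma hankel_const_eq: "hankel_const (Suc m) = (\<Prod>j<Suc m. hankel_pivot j :: 'a :: field_char_0)"
proof (induction m)
  case (Suc m)
  let ?d = "\<lambda>k. of_nat (double_fact k) :: 'a"
  have d: "(\<Prod>k = 1..m. ?d k ^ 6) = (\<Prod>k = 1..m - 1. ?d k ^ 6) * ?d m ^ 6"
    by (cases m) simp_all
  have "(of_nat (fact (Suc m)) :: 'a) = of_nat (double_fact (Suc m) * double_fact m)"
    by (simp only: fact_eq_double_fact)
  then have f: "fact (Suc m) = ?d (Suc m) * ?d m"
    by (simp only: of_nat_fact of_nat_mult)
  have c: "Suc (Suc m) choose 2 = (Suc m choose 2) + Suc m"
    by (simp add: numeral_2_eq_2)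
  have nz: "?d m \<noteq> 0" "?d (Suc m) \<noteq> 0"
    using double_fact_pos[of m] double_fact_pos[of "Suc m"] by simp_all
  have sub: "Suc m - 1 = m" "Suc m - 2 = m - 1" "Suc (Suc m) - 1 = Suc m" "Suc (Suc m) - 2 = m"
    by simp_all
  have "(\<Prod>i = 1..Suc m. fact i) = (\<Prod>i = 1..m. fact i) * (?d (Suc m) * ?d m)"
    unfolding f[symmetric] by simp
  then have step: "hankel_const (Suc (Suc m)) = 2 ^ (Suc m choose 2) * 2 ^ Suc m * ?d (Suc m) ^ 2 *
      ((\<Prod>k = 1..m - 1. ?d k ^ 6) * ?d m ^ 6) / ((\<Prod>i = 1..m. fact i) * (?d (Suc m) * ?d m))"
    by (simp only: hankel_const_def sub c d power_add)
  have cancel: "p * q * y ^ 2 * (A * x ^ 6) / (B * (y * x)) = p * x ^ 2 * A / B * (q * (y * x) * x ^ 2)"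
    if "x \<noteq> 0" "y \<noteq> 0" for p q x y A B :: 'a
    using that by (cases "B = 0") (simp_all add: field_simps eval_nat_numeral)
  have "hankel_const (Suc (Suc m)) = (hankel_const (Suc m) :: 'a) * hankel_pivot (Suc m)"
    unfolding step cancel[OF nz] unfolding hankel_const_def hankel_pivot_def f sub ..
  then show ?case
    by (simp add: Suc.IH)
qed (simp add: hankel_const_def hankel_pivot_def numeral_2_eq_2)

lemma prod_pochhammer:
  fixes s :: "'a :: comm_ring_1"
  shows "(\<Prod>i = 1..m. pochhammer (s + 1) i) = (\<Prod>j = 1..m. (s + of_nat j) ^ (Suc m - j))"
proof (induction m)
  case (Suc m)
  have "pochhammer (s + 1) (Suc m) = (\<Prod>j = 1..Suc m. s + of_nat j)"
    by (induction m) (simp_all add: pochhammer_Suc algebra_simps)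
  \<comment> \<open>Each exponent grows by one. The new index \<open>j = Suc m\<close> has exponent
    0 in the old product and can be included there.\<close>
  moreover have "(\<Prod>j = 1..Suc m. (s + of_nat j) ^ (Suc (Suc m) - j)) =
      (\<Prod>j = 1..Suc m. (s + of_nat j) * (s + of_nat j) ^ (Suc m - j))"
    by (intro prod.cong refl) (simp add: Suc_diff_le)
  ultimately show ?case
    using Suc.IH by (simp add: prod.distrib)
qed simp

text \<open>The \<open>k\<close>-th coefficient of the composition involves only the powers
  \<open>?u ^ i\<close> with \<open>i \<le> k\<close>, so it is a finite combination of the
  binomials \<open>- (s + 1) gchoose i\<close>, which are polynomials in \<open>s\<close>.\<close>

lemma cos_series_nth_poly:
  "\<exists>F :: 'a :: field_char_0 poly fps. \<forall>s k. cos_series s $ k = poly (F $ k) s"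
proof -
  let ?u = "fps_cos 1 - 1 :: 'a fps"
  define p :: "nat \<Rightarrow> 'a poly" where
    "p i = smult (1 / fact i) (\<Prod>l = 0..<i. - [:1, 1:] - of_nat l)" for i
  have p: "poly (p i) s = - (s + 1) gchoose i" for i s
    by (simp add: p_def gbinomial_prod_rev poly_prod add.commute)
  define S where "S k = (\<Sum>i = 0..k. smult (?u ^ i $ k) (p i))" for k
  define F where "F = (1 + fps_X) * Abs_fps S"
  have "sec_power (s + 1) $ k = poly (S k) s" for s k
    by (simp add: S_def sec_power_def fps_compose_nth poly_sum p mult.commute)
  then have "cos_series s $ k = poly (F $ k) s" for s k
    by (cases k) (simp_all add: cos_series_eq F_def distrib_right del: sec_power_nth_0)
  then show ?thesis
    by blast
qed

theorem theorem12p1: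
  fixes n :: nat
  assumes "n \<ge> 1"
  shows "(\<exists>F :: 'a :: field_char_0 poly fps.
            \<forall>s k. fps_nth (cos_series s) k = poly (fps_nth F k) s) \<and>
         (\<forall>s :: 'a.
            dilated_hankel n (cos_series s) =
              hankel_const n * (\<Prod>i = 1..n - 1. pochhammer (s + 1) i) \<and>
            hankel_const n * (\<Prod>i = 1..n - 1. pochhammer (s + 1) i) =
              hankel_const n * (\<Prod>j = 1..n - 1. (s + of_nat j) ^ (n - j))) \<and>
         (hankel_const n :: 'a) =
           dilated_hankel n (cos_series (0 :: 'a)) / (\<Prod>i = 1..n - 1. fact i)"
proof -
  obtain m where n: "n = Suc m"
    using assms by (cases n) auto
  have "(\<Prod>j<n. pochhammer (s + 1) j) = (\<Prod>i = 1..n - 1. pochhammer (s + 1) i)" for s :: 'a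
    unfolding n by (induction m) simp_all
  then have H: "dilated_hankel n (cos_series s) =
      hankel_const n * (\<Prod>i = 1..n - 1. pochhammer (s + 1) i)" for s :: 'a
    unfolding dilated_hankel_cos_series n hankel_const_eq by simp
  have "(\<Prod>i = 1..n - 1. fact i :: 'a) \<noteq> 0"
    by simp
  \<comment> \<open>At \<open>s = 0\<close> each \<open>pochhammer (s + 1) i\<close> is
    \<open>i!\<close>.\<close>
  then have "(hankel_const n :: 'a) = dilated_hankel n (cos_series (0 :: 'a)) / (\<Prod>i = 1..n - 1. fact i)"
    unfolding H by (simp add: pochhammer_fact[symmetric])
  moreover have P: "(\<Prod>i = 1..n - 1. pochhammer (s + 1) i) = (\<Prod>j = 1..n - 1. (s + of_nat j) ^ (n - j))"
    for s :: 'a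
    using prod_pochhammer[of s m] by (simp add: n)
  ultimately show ?thesis
    using cos_series_nth_poly by (intro conjI allI H) (simp_all only: P)
qed

end
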